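(* Let $L_0$ be a simplicial sphere on the vertex set $[m]=\{1,\dots,m\}$ and let $K$ be a simplicial complex on the vertex set $[m]$ that is a subcomplex of $L_0$ but not a full subcomplex of $L_0$. Let $\mathbb{M}=\{\sigma_1,\sigma_2,\dots,\sigma_s\}$ be the set of missing faces of $K$ (as a complex on $[m]$), and assume that each $\sigma_i$ is also a simplex of $L_0$. Perform stellar subdivisions at $\sigma_1,\dots,\sigma_s$ successively: \[ L_1=ss_{\sigma_1}L_0,\quad L_2=ss_{\sigma_2}L_1,\quad \dots,\quad L_s=ss_{\sigma_s}L_{s-1}, \] where $L_i$ is a complex on the vertex set $[m+i]$, the new vertex introduced in the $i$-th step being $m+i$. Then $K$ is a full subcomplex of $L_s$; namely $K=L_s|_{[m]}$.
   Context: An abstract simplicial complex on a finite vertex set $I$ is a collection of subsets of $I$ (simplices, or faces) closed under taking subsets; elements of $I$ need not be vertices of the complex (ghost vertices are allowed). A simplicial sphere is a simplicial complex whose geometric realization is homeomorphic to a sphere. A missing face (minimal non-face) of a complex $K$ on $I$ is a subset $\sigma\subseteq I$ with $\sigma\notin K$ such that all proper subsets of $\sigma$ belong to $K$. For $J\subseteq I$, the full subcomplex of $K$ on $J$ is $K|_J=\{\tau\in K \mid \tau\subseteq J\}$. Stellar subdivision: for a complex $K$ on $[n]$ and a simplex $\sigma\in K$, put $Intstar_K\sigma=\{\tau\in K\mid \sigma\subseteq\tau\}$ and $\partial star_K\sigma=\{\tau\in K\mid \sigma\cup\tau\in K,\ \sigma\not\subseteq\tau\}$. The stellar subdivision of $K$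 at $\sigma$ is the complex on $[n+1]$ \[ ss_\sigma K=(K\setminus Intstar_K\sigma)\cup (cone\,\partial star_K\sigma), \] where $cone\,\partial star_K\sigma=\{\tau,\ \tau\cup\{n+1\}\mid \tau\in\partial star_K\sigma\}$ is the cone with the new vertex $n+1$ as apex. *)

theory Defs
  imports "HOL-Analysis.Analysis"
begin

(* Elements of I need not be vertices (ghost vertices). The void complex {} is not excluded;
   it is different from the complex {{}} whose only simplex is the empty one. *)
definition abstract_complex :: "'a set \<Rightarrow> 'a set set \<Rightarrow> bool" where
  "abstract_complex I K \<longleftrightarrow>
     finite I \<and> K \<subseteq> Pow I \<and> (\<forall>\<tau>\<in>K. \<forall>\<rho>. \<rho> \<subseteq> \<tau> \<longrightarrow> \<rho> \<in> K)"

(* Barycentric coordinates: the points of R^I that are convex combinations of the unit vectors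
   indexed by some simplex of K. *)
definition geometric_realization :: "'a set \<Rightarrow> 'a set set \<Rightarrow> ('a \<Rightarrow> real) topology" where
  "geometric_realization I K =
     subtopology (product_topology (\<lambda>_. euclideanreal) I)
       {x. (\<forall>i\<in>I. 0 \<le> x i) \<and> (\<Sum>i\<in>I. x i) = 1 \<and> {i\<in>I. x i \<noteq> 0} \<in> K}"

(* The complex {{}} has empty realization and is the sphere of dimension -1, which the library's
   nsphere n, the unit sphere in R^(n+1), does not cover. *)
definition simplicial_sphere :: "'a set \<Rightarrow> 'a set set \<Rightarrow> bool" where
  "simplicial_sphere I K \<longleftrightarrow>
     abstract_complex I K \<and>
     (K = {{}} \<or> (\<exists>n. geometric_realization I K homeomorphic_space nsphere n))"

definition missing_faces :: "'a set \<Rightarrow> 'a set set \<Rightarrow> 'a set set" where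
  "missing_faces I K = {\<sigma>. \<sigma> \<subseteq> I \<and> \<sigma> \<notin> K \<and> (\<forall>\<tau>. \<tau> \<subset> \<sigma> \<longrightarrow> \<tau> \<in> K)}"

definition restrict_complex :: "'a set set \<Rightarrow> 'a set \<Rightarrow> 'a set set" where
  "restrict_complex K J = {\<tau>\<in>K. \<tau> \<subseteq> J}"

definition full_subcomplex :: "'a set \<Rightarrow> 'a set set \<Rightarrow> 'a set set \<Rightarrow> bool" where
  "full_subcomplex I K L \<longleftrightarrow> (\<exists>J. J \<subseteq> I \<and> K = restrict_complex L J)"

definition int_star :: "'a set set \<Rightarrow> 'a set \<Rightarrow> 'a set set" where
  "int_star K \<sigma> = {\<tau>\<in>K. \<sigma> \<subseteq> \<tau>}"

definition boundary_star :: "'a set set \<Rightarrow> 'a set \<Rightarrow> 'a set set" where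
  "boundary_star K \<sigma> = {\<tau>\<in>K. \<sigma> \<union> \<tau> \<in> K \<and> \<not> \<sigma> \<subseteq> \<tau>}"

definition cone :: "'a \<Rightarrow> 'a set set \<Rightarrow> 'a set set" where
  "cone v K = K \<union> {\<tau> \<union> {v} |\<tau>. \<tau> \<in> K}"

(* For a complex K on {1..n} and \<sigma> \<in> K; the new vertex is n + 1. *)
definition stellar_subdivision :: "nat \<Rightarrow> nat set \<Rightarrow> nat set set \<Rightarrow> nat set set" where
  "stellar_subdivision n \<sigma> K = (K - int_star K \<sigma>) \<union> cone (n + 1) (boundary_star K \<sigma>)"

end

theory Submission
  imports Defs
begin

text \<open>A stellar subdivision at \<open>\<sigma>\<close> adds no simplex on the old vertices and deletes exactly
  those containing \<open>\<sigma>\<close>. Hence the simplices of the final complex on the original vertices are the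
  simplices of the original sphere that contain no missing face of \<open>K\<close>, and these are the simplices
  of \<open>K\<close>. Missing faces form an antichain, so each one survives the subdivisions at the earlier
  ones.\<close>

text \<open>\<open>int_star K \<sigma>\<close> is closed upwards in \<open>K\<close>, so removing it
  leaves a complex. The boundary star is closed downwards, because \<open>\<sigma> \<union> \<rho>
  \<subseteq> \<sigma> \<union> \<tau>\<close> whenever \<open>\<rho> \<subseteq> \<tau>\<close>,
  and a cone over a complex is again a complex.\<close>

lemma abstract_complex_stellar_subdivision:
  assumes "abstract_complex {1..n} K"
  shows "abstract_complex {1..n + 1} (stellar_subdivision n \<sigma> K)"
proof -
  have sub: "K \<subseteq> Pow {1..n}" and down: "\<And>\<tau> \<rho>. \<tau> \<in> K \<Longrightarrow> \<rho> \<subseteq> \<tau> \<Longrightarrow> \<rho> \<in> K"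
    using assms by (auto simp: abstract_complex_def)
  define B where "B = boundary_star K \<sigma>"
  have B_sub: "B \<subseteq> K"
    by (auto simp: B_def boundary_star_def)
  have B_down: "\<rho> \<in> B" if "\<tau> \<in> B" "\<rho> \<subseteq> \<tau>" for \<tau> \<rho>
  proof -
    have "\<sigma> \<union> \<rho> \<in> K"
      by (rule down[of "\<sigma> \<union> \<tau>"]) (use that in \<open>auto simp: B_def boundary_star_def\<close>)
    then show ?thesis
      using that down[of \<tau> \<rho>] by (auto simp: B_def boundary_star_def)
  qed
  have "stellar_subdivision n \<sigma> K \<subseteq> Pow {1..n + 1}"
  proof -
    have "K \<subseteq> Pow {1..n + 1}"
      using sub by fastforce
    then show ?thesis
      using B_sub unfolding stellar_subdivision_def cone_def B_def[symmetric] by auto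
  qed
  moreover have "\<rho> \<in> stellar_subdivision n \<sigma> K"
    if \<tau>: "\<tau> \<in> stellar_subdivision n \<sigma> K" and \<rho>: "\<rho> \<subseteq> \<tau>" for \<tau> \<rho>
  proof -
    consider "\<tau> \<in> K - int_star K \<sigma>" | "\<tau> \<in> B" | \<tau>' where "\<tau>' \<in> B" "\<tau> = \<tau>' \<union> {n + 1}"
      using \<tau> unfolding stellar_subdivision_def cone_def B_def by blast
    then show ?thesis
    proof cases
      case 1
      then have "\<rho> \<in> K - int_star K \<sigma>"
        using down[of \<tau> \<rho>] \<rho> by (auto simp: int_star_def)
      then show ?thesis
        by (simp add: stellar_subdivision_def)
    next
      case 2
      then show ?thesis
        using B_down \<rho> by (auto simp: stellar_subdivision_def cone_def B_def)
    next
      case 3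
      \<comment> \<open>Deleting the apex from a face of \<open>\<tau>' \<union> {n + 1}\<close>
        leaves a face of \<open>\<tau>'\<close>.\<close>
      then have *: "\<rho> - {n + 1} \<in> B"
        using B_down \<rho> by (metis Diff_subset_conv Un_commute)
      have "\<rho> \<in> cone (n + 1) B"
      proof (cases "n + 1 \<in> \<rho>")
        case True
        then have "\<rho> = (\<rho> - {n + 1}) \<union> {n + 1}"
          by auto
        then show ?thesis
          unfolding cone_def using * by blast
      next
        case False
        then show ?thesis
          using * by (simp add: cone_def)
      qed
      then show ?thesis
        by (simp add: stellar_subdivision_def B_def)
    qed
  qed
  ultimately show ?thesis
    unfolding abstract_complex_def by blast
qed

text \<open>Cone simplices that avoid the apex lie in the boundary star, hence already in
  \<open>K - int_star K \<sigma>\<close>. Since \<open>J\<close> is arbitrary apart from missing the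
  apex, it can stay fixed while the vertex set grows.\<close>

lemma restrict_stellar_subdivision:
  assumes "n + 1 \<notin> J"
  shows "restrict_complex (stellar_subdivision n \<sigma> K) J = {\<tau> \<in> restrict_complex K J. \<not> \<sigma> \<subseteq> \<tau>}"
  using assms
  by (auto simp: restrict_complex_def stellar_subdivision_def cone_def int_star_def boundary_star_def)

text \<open>A proper subset of a missing face lies in \<open>K\<close>, whereas a missing face does
  not.\<close>

lemma missing_faces_antichain:
  assumes "\<sigma> \<in> missing_faces I K" "\<tau> \<in> missing_faces I K" "\<sigma> \<subseteq> \<tau>"
  shows "\<sigma> = \<tau>"
  using assms unfolding missing_faces_def by blast

text \<open>A non-face that is not minimal has a smaller non-face inside it; by finiteness this
  descent ends at a missing face.\<close>

lemma nonface_contains_missing_face: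
  assumes "finite I" "\<tau> \<subseteq> I" "\<tau> \<notin> K"
  obtains \<sigma> where "\<sigma> \<in> missing_faces I K" "\<sigma> \<subseteq> \<tau>"
proof -
  have "finite \<tau>"
    using assms finite_subset by blast
  then have "\<exists>\<sigma> \<in> missing_faces I K. \<sigma> \<subseteq> \<tau>"
    using assms(2,3)
  proof (induction \<tau> rule: finite_psubset_induct)
    case (psubset \<tau>)
    show ?case
    proof (cases "\<tau> \<in> missing_faces I K")
      case False
      then obtain \<rho> where "\<rho> \<subset> \<tau>" "\<rho> \<notin> K"
        using psubset.prems by (auto simp: missing_faces_def)
      then show ?thesis
        using psubset.IH[of \<rho>] psubset.prems by blast
    qed blast
  qed
  then show thesis
    using that by blast
qed

lemma abstract_complex_eq_avoiding_missing_faces: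
  assumes "abstract_complex I K" "K \<subseteq> L" "L \<subseteq> Pow I"
  shows "K = {\<tau> \<in> L. \<forall>\<sigma> \<in> missing_faces I K. \<not> \<sigma> \<subseteq> \<tau>}"
proof (intro equalityI subsetI)
  fix \<tau> assume "\<tau> \<in> K"
  moreover have "\<rho> \<in> K" if "\<rho> \<subseteq> \<tau>" for \<rho>
    using assms(1) \<open>\<tau> \<in> K\<close> that unfolding abstract_complex_def by blast
  ultimately show "\<tau> \<in> {\<tau> \<in> L. \<forall>\<sigma> \<in> missing_faces I K. \<not> \<sigma> \<subseteq> \<tau>}"
    using assms(2) unfolding missing_faces_def by blast
next
  fix \<tau> assume \<tau>: "\<tau> \<in> {\<tau> \<in> L. \<forall>\<sigma> \<in> missing_faces I K. \<not> \<sigma> \<subseteq> \<tau>}"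
  show "\<tau> \<in> K"
  proof (rule ccontr)
    assume "\<tau> \<notin> K"
    moreover have "finite I" "\<tau> \<subseteq> I"
      using assms(1,3) \<tau> by (auto simp: abstract_complex_def)
    ultimately obtain \<sigma> where "\<sigma> \<in> missing_faces I K" "\<sigma> \<subseteq> \<tau>"
      using nonface_contains_missing_face by metis
    then show False
      using \<tau> by simp
  qed
qed

theorem theorem3p2:
  fixes m s :: nat
    and K :: "nat set set"
    and \<sigma> :: "nat \<Rightarrow> nat set"
    and L :: "nat \<Rightarrow> nat set set"
  assumes "simplicial_sphere {1..m} (L 0)"
    and "abstract_complex {1..m} K"
    and "K \<subseteq> L 0"
    and "\<not> full_subcomplex {1..m} K (L 0)"
    and "bij_betw \<sigma> {1..s} (missing_faces {1..m} K)"
    and "\<And>i. i \<in> {1..s} \<Longrightarrow> \<sigma> i \<in> L 0"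
    and "\<And>i. i \<in> {1..s} \<Longrightarrow> L i = stellar_subdivision (m + (i - 1)) (\<sigma> i) (L (i - 1))"
  shows "(\<forall>i\<in>{1..s}. \<sigma> i \<in> L (i - 1) \<and> abstract_complex {1..m + i} (L i)) \<and>
    full_subcomplex {1..m + s} K (L s) \<and> K = restrict_complex (L s) {1..m}"
proof -
  have L0: "abstract_complex {1..m} (L 0)"
    using assms(1) by (simp add: simplicial_sphere_def)
  \<comment> \<open>The right-hand side refers back to \<open>L 0\<close>, so each step only adds
    one more forbidden subset.\<close>
  have invariant: "abstract_complex {1..m + i} (L i) \<and>
      restrict_complex (L i) {1..m} = {\<tau> \<in> L 0. \<forall>j\<in>{1..i}. \<not> \<sigma> j \<subseteq> \<tau>}" if "i \<le> s" for i
    using that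
  proof (induction i)
    case 0
    then show ?case
      using L0 by (auto simp: abstract_complex_def restrict_complex_def)
  next
    case (Suc i)
    have step: "L (Suc i) = stellar_subdivision (m + i) (\<sigma> (Suc i)) (L i)"
      using assms(7)[of "Suc i"] Suc.prems by simp
    have "restrict_complex (L (Suc i)) {1..m}
        = {\<tau> \<in> restrict_complex (L i) {1..m}. \<not> \<sigma> (Suc i) \<subseteq> \<tau>}"
      \<comment> \<open>The new vertex is \<open>m + i + 1\<close>, which lies outside
        \<open>{1..m}\<close> for every \<open>i\<close>.\<close>
      unfolding step by (rule restrict_stellar_subdivision) simp
    also have "\<dots> = {\<tau> \<in> L 0. \<forall>j\<in>{1..Suc i}. \<not> \<sigma> j \<subseteq> \<tau>}"
      using Suc by (auto simp: atLeastAtMostSuc_conv)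
    finally show ?case
      using abstract_complex_stellar_subdivision[of "m + i" "L i" "\<sigma> (Suc i)"] Suc step by simp
  qed
  have "\<sigma> i \<in> L (i - 1)" if i: "i \<in> {1..s}" for i
  proof -
    \<comment> \<open>By the invariant at \<open>i - 1\<close>, this is what
      \<open>\<sigma> i\<close> needs in order to survive; the range is empty for
      \<open>i = 1\<close>.\<close>
    have "\<not> \<sigma> j \<subseteq> \<sigma> i" if j: "j \<in> {1..i - 1}" for j
    proof
      assume sub: "\<sigma> j \<subseteq> \<sigma> i"
      have j': "j \<in> {1..s}" and "j \<noteq> i"
        using i j by auto
      have "\<sigma> j = \<sigma> i"
        using missing_faces_antichain[OF _ _ sub] bij_betwE[OF assms(5)] i j' by blast
      then show False
        using bij_betw_imp_inj_on[OF assms(5)] i j' \<open>j \<noteq> i\<close> by (auto dest: inj_onD)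
    qed
    then have "\<sigma> i \<in> restrict_complex (L (i - 1)) {1..m}"
      using invariant[of "i - 1"] assms(6)[OF i] i by auto
    then show ?thesis
      by (simp add: restrict_complex_def)
  qed
  moreover have K: "K = restrict_complex (L s) {1..m}"
  proof -
    have "K = {\<tau> \<in> L 0. \<forall>\<rho> \<in> missing_faces {1..m} K. \<not> \<rho> \<subseteq> \<tau>}"
      using L0 assms(2,3)
      by (intro abstract_complex_eq_avoiding_missing_faces) (auto simp: abstract_complex_def)
    also have "\<dots> = restrict_complex (L s) {1..m}"
      \<comment> \<open>Writing the set of missing faces as the image of \<open>{1..s}\<close> under
        \<open>\<sigma>\<close> turns avoidance of all of them into the invariant at
        \<open>s\<close>.\<close>
      unfolding bij_betw_imp_surj_on[OF assms(5), symmetric] using invariant[of s] by simp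
    finally show ?thesis .
  qed
  moreover have "full_subcomplex {1..m + s} K (L s)"
    unfolding full_subcomplex_def by (rule exI[of _ "{1..m}"], rule conjI[OF _ K]) auto
  moreover have "\<forall>i\<in>{1..s}. abstract_complex {1..m + i} (L i)"
    using invariant by auto
  ultimately show ?thesis
    by blast
qed

end
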